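(* Let $i\ge 0$ be an integer. All geodesic triangles in an $\alpha_i$-metric graph $G$ are $3(i+1)$-thin.
   Context: All graphs are finite, undirected, unweighted, simple and connected; $d$ is the shortest-path distance and $I(u,v)=\{w : d(u,v)=d(u,w)+d(w,v)\}$. A graph is $\alpha_i$-metric if for all vertices $u,v,w,x$ with $v\in I(u,w)$, $w\in I(v,x)$ and $v,w$ adjacent, $d(u,x)\ge d(u,v)+d(v,x)-i$. A geodesic triangle $\Delta(x,y,z)=P(x,y)\cup P(y,z)\cup P(z,x)$ is the union of a shortest $(x,y)$-path, a shortest $(y,z)$-path and a shortest $(z,x)$-path. The Gromov product is $(x\mid y)_z=\frac12(d(x,z)+d(y,z)-d(x,y))$. Let $T(x,y,z)$ be the metric star (tree) with leaves $x,y,z$ whose edges to the center have lengths $(y\mid z)_x$, $(z\mid x)_y$, $(x\mid y)_z$ respectively (edges viewed as continuous segments), and let $\varphi:\Delta(x,y,z)\to T(x,y,z)$ be the unique map whose restriction to each side $P(x,y),P(y,z),P(z,x)$ is an isometry onto the corresponding path of $T$. The triangle is $\delta$-thin if for all vertices $u,v$ of $\Delta(x,y,z)$ with $\varphi(u)=\varphi(v)$ one has $d_G(u,v)\le\delta$. *)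

theory Defs
  imports Complex_Main "Graph_Theory.Graph_Theory" "HOL-Library.FuncSet"
begin

context pre_digraph
begin

text \<open>Only meaningful for \<open>v\<close> reachable from \<open>u\<close>; the statement is about connected graphs.\<close>

definition gdist :: "'a \<Rightarrow> 'a \<Rightarrow> nat" where
  "gdist u v = (LEAST n. \<exists>p. awalk u p v \<and> length p = n)"

definition interval :: "'a \<Rightarrow> 'a \<Rightarrow> 'a set" where
  "interval u v = {w \<in> verts G. gdist u v = gdist u w + gdist w v}"

definition alpha_metric :: "nat \<Rightarrow> bool" where
  "alpha_metric i \<longleftrightarrow>
     (\<forall>u \<in> verts G. \<forall>v \<in> verts G. \<forall>w \<in> verts G. \<forall>x \<in> verts G.
        v \<in> interval u w \<longrightarrow> w \<in> interval v x \<longrightarrow> v \<rightarrow>\<^bsub>G\<^esub> w \<longrightarrow>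
        int (gdist u x) \<ge> int (gdist u v) + int (gdist v x) - int i)"

definition shortest_walk :: "'a \<Rightarrow> 'b awalk \<Rightarrow> 'a \<Rightarrow> bool" where
  "shortest_walk u p v \<longleftrightarrow> awalk u p v \<and> length p = gdist u v"

definition geodesic_triangle ::
  "'a \<Rightarrow> 'a \<Rightarrow> 'a \<Rightarrow> 'b awalk \<Rightarrow> 'b awalk \<Rightarrow> 'b awalk \<Rightarrow> bool" where
  "geodesic_triangle x y z p q r \<longleftrightarrow>
     shortest_walk x p y \<and> shortest_walk y q z \<and> shortest_walk z r x"

definition triangle_verts ::
  "'a \<Rightarrow> 'a \<Rightarrow> 'a \<Rightarrow> 'b awalk \<Rightarrow> 'b awalk \<Rightarrow> 'b awalk \<Rightarrow> 'a set" where
  "triangle_verts x y z p q r =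
     set (awalk_verts x p) \<union> set (awalk_verts y q) \<union> set (awalk_verts z r)"

text \<open>\<open>gromov x y z\<close> is $(x \mid y)_z$: the base point is the last argument.\<close>

definition gromov :: "'a \<Rightarrow> 'a \<Rightarrow> 'a \<Rightarrow> real" where
  "gromov x y z = (real (gdist x z) + real (gdist y z) - real (gdist x y)) / 2"

end

text \<open>The metric star with three legs is realised as the union of three segments, one on each
  non-negative coordinate axis of $\mathbb{R}^3$, with the $\ell_1$ metric. The centre is the
  origin; two points on the same leg are at distance $|s - t|$, two points on different legs at
  distance $s + t$, as in the tree.\<close>

type_synonym star_point = "real \<times> real \<times> real"

definition star_dist :: "star_point \<Rightarrow> star_point \<Rightarrow> real" where
  "star_dist s t = (case (s, t) of ((a, b, c), (a', b', c')) \<Rightarrow>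
     \<bar>a - a'\<bar> + \<bar>b - b'\<bar> + \<bar>c - c'\<bar>)"

definition leg1 :: "real \<Rightarrow> star_point set" where "leg1 a = (\<lambda>t. (t, 0, 0)) ` {0..a}"
definition leg2 :: "real \<Rightarrow> star_point set" where "leg2 b = (\<lambda>t. (0, t, 0)) ` {0..b}"
definition leg3 :: "real \<Rightarrow> star_point set" where "leg3 c = (\<lambda>t. (0, 0, t)) ` {0..c}"

context pre_digraph
begin

text \<open>The sides of a triangle are represented by their vertices only, and so an isometry of a side
  onto a path of the star becomes an isometric embedding of its vertices into that path with the
  ends of the side going to the ends of the path.\<close>

definition isometric_into :: "('a \<Rightarrow> star_point) \<Rightarrow> 'a set \<Rightarrow> star_point set \<Rightarrow> bool" where
  "isometric_into \<phi> U S \<longleftrightarrow>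
     \<phi> ` U \<subseteq> S \<and> (\<forall>u \<in> U. \<forall>v \<in> U. star_dist (\<phi> u) (\<phi> v) = real (gdist u v))"

definition star_map ::
  "'a \<Rightarrow> 'a \<Rightarrow> 'a \<Rightarrow> 'b awalk \<Rightarrow> 'b awalk \<Rightarrow> 'b awalk \<Rightarrow> ('a \<Rightarrow> star_point) \<Rightarrow> bool" where
  "star_map x y z p q r \<phi> \<longleftrightarrow>
     (let a = gromov y z x; b = gromov z x y; c = gromov x y z in
        \<phi> x = (a, 0, 0) \<and> \<phi> y = (0, b, 0) \<and> \<phi> z = (0, 0, c) \<and>
        isometric_into \<phi> (set (awalk_verts x p)) (leg1 a \<union> leg2 b) \<and>
        isometric_into \<phi> (set (awalk_verts y q)) (leg2 b \<union> leg3 c) \<and>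
        isometric_into \<phi> (set (awalk_verts z r)) (leg3 c \<union> leg1 a))"

text \<open>The quantifier over \<open>\<phi>\<close> ranges over a single map up to its values off the triangle, see
  \<open>ex1_star_map\<close> below.\<close>

definition thin_triangle ::
  "real \<Rightarrow> 'a \<Rightarrow> 'a \<Rightarrow> 'a \<Rightarrow> 'b awalk \<Rightarrow> 'b awalk \<Rightarrow> 'b awalk \<Rightarrow> bool" where
  "thin_triangle \<delta> x y z p q r \<longleftrightarrow>
     (\<forall>\<phi>. star_map x y z p q r \<phi> \<longrightarrow>
        (\<forall>u \<in> triangle_verts x y z p q r. \<forall>v \<in> triangle_verts x y z p q r.
           \<phi> u = \<phi> v \<longrightarrow> real (gdist u v) \<le> \<delta>))"

lemma gdist_le: "awalk u p v \<Longrightarrow> gdist u v \<le> length p"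
  unfolding gdist_def by (rule Least_le) blast

lemma gdist_awalk:
  assumes "awalk u p v"
  obtains q where "awalk u q v" "length q = gdist u v"
proof -
  have "\<exists>q. awalk u q v \<and> length q = gdist u v"
    unfolding gdist_def by (rule LeastI_ex) (use assms in blast)
  then show ?thesis using that by blast
qed

end

lemma (in wf_digraph) gdist_eq_shortest_path:
  assumes "u \<rightarrow>\<^sup>* v"
  shows "ereal (real (gdist u v)) = \<mu> (\<lambda>_. 1) u v"
proof -
  obtain p where "awalk u p v" using assms by (auto simp: reachable_awalk)
  then obtain q where q: "awalk u q v" "length q = gdist u v" by (rule gdist_awalk)
  have cost: "awalk_cost (\<lambda>_. 1) p = real (length p)" for p :: "'b awalk"
    by (induct p) auto
  show ?thesis
    unfolding \<mu>_def cost
    by (rule antisym) (use q in \<open>auto intro!: INF_greatest INF_lower2[of q] gdist_le\<close>)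
qed

locale connected_graph = graph +
  assumes conn: "Digraph_Component.connected G"
begin

lemma ex_shortest:
  assumes "u \<in> verts G" "v \<in> verts G"
  obtains q where "awalk u q v" "length q = gdist u v"
proof -
  have "u \<rightarrow>\<^sup>*\<^bsub>mk_symmetric G\<^esub> v"
    using conn assms unfolding connected_def strongly_connected_def by simp
  then have "u \<rightarrow>\<^sup>* v" unfolding reachable_mk_symmetric_eq[OF sym_arcs] .
  then obtain p where "awalk u p v" by (auto simp: reachable_awalk)
  then show ?thesis using gdist_awalk that by blast
qed

lemma awalk_ends_in:
  assumes "awalk u p v"
  shows "u \<in> set (awalk_verts u p)" "v \<in> set (awalk_verts u p)"
proof -
  have "awhd u p = u" "awlast u p = v" by (rule awalkE'[OF assms], assumption)+
  moreover have "awalk_verts u p \<noteq> []" by (cases p) auto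
  ultimately show "u \<in> set (awalk_verts u p)" "v \<in> set (awalk_verts u p)"
    using hd_in_set[of "awalk_verts u p"] last_in_set[of "awalk_verts u p"] by simp_all
qed

lemma awalk_in_verts: "awalk u p v \<Longrightarrow> u \<in> verts G" "awalk u p v \<Longrightarrow> v \<in> verts G"
  by (erule awalkE', assumption)+

lemma gdist_triangle:
  assumes "u \<in> verts G" "v \<in> verts G" "w \<in> verts G"
  shows "gdist u w \<le> gdist u v + gdist v w"
proof -
  obtain p where p: "awalk u p v" "length p = gdist u v" using ex_shortest assms by blast
  obtain q where q: "awalk v q w" "length q = gdist v w" using ex_shortest assms by blast
  show ?thesis using gdist_le[OF awalk_appendI[OF p(1) q(1)]] p q by simp
qed

lemma awalk_rev: "awalk u p v \<Longrightarrow> \<exists>q. awalk v q u \<and> length q = length p"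
proof (induct p arbitrary: u)
  case Nil
  then show ?case by (auto simp: awalk_Nil_iff)
next
  case (Cons e p)
  then obtain q where q: "awalk v q (head G e)" "length q = length p"
    by (auto simp: awalk_Cons_iff)
  from Cons.prems have e: "e \<in> arcs G" "tail G e = u" by (auto simp: awalk_Cons_iff)
  then obtain e' where "e' \<in> arcs G" "tail G e' = head G e" "head G e' = u"
    using sym_arcs[unfolded symmetric_conv, rule_format, OF e(1)] by auto
  then have "awalk (head G e) [e'] u" by (auto simp: awalk_Cons_iff awalk_Nil_iff)
  with q(1) have "awalk v (q @ [e']) u" by (rule awalk_appendI)
  with q(2) show ?case by (intro exI[of _ "q @ [e']"]) simp
qed

lemma gdist_sym:
  assumes "u \<in> verts G" "v \<in> verts G"
  shows "gdist u v = gdist v u"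
proof -
  have "gdist a b \<le> gdist b a" if ab: "a \<in> verts G" "b \<in> verts G" for a b
  proof -
    obtain q where q: "awalk b q a" "length q = gdist b a" using ex_shortest[OF ab(2,1)] .
    from awalk_rev[OF q(1)] obtain p where "awalk a p b" "length p = length q" by blast
    with gdist_le[of a p b] q(2) show ?thesis by simp
  qed
  with assms show ?thesis by (simp add: antisym)
qed

lemma gdist_refl [simp]: "u \<in> verts G \<Longrightarrow> gdist u u = 0"
  using gdist_le[of u "[]" u] by (simp add: awalk_Nil_iff)

lemma shortest_walk_split:
  assumes "shortest_walk u p v" "w \<in> set (awalk_verts u p)"
  shows "w \<in> verts G" "gdist u v = gdist u w + gdist w v"
    "\<exists>q r. p = q @ r \<and> awalk u q w \<and> length q = gdist u w"
proof -
  have p: "awalk u p v" "length p = gdist u v" using assms by (simp_all add: shortest_walk_def)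
  then obtain q r where qr: "p = q @ r" "awalk u q w" "awalk w r v"
    using awalk_decomp[OF p(1) assms(2)] by blast
  show w: "w \<in> verts G" using qr(3) by (rule awalk_in_verts)
  have "gdist u w \<le> length q" "gdist w v \<le> length r" using gdist_le qr by blast+
  moreover have "gdist u v \<le> gdist u w + gdist w v"
    using gdist_triangle awalk_in_verts[OF p(1)] w by blast
  moreover have "length q + length r = gdist u v" using p(2) qr(1) by simp
  ultimately have e: "gdist u v = gdist u w + gdist w v" "length q = gdist u w" by linarith+
  show "gdist u v = gdist u w + gdist w v" by (rule e)
  show "\<exists>q r. p = q @ r \<and> awalk u q w \<and> length q = gdist u w" using e qr by blast
qed

lemma shortest_walk_dist:
  assumes sw: "shortest_walk u p v" and s: "s \<in> set (awalk_verts u p)"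
    and t: "t \<in> set (awalk_verts u p)"
  shows "real (gdist s t) = \<bar>real (gdist u s) - real (gdist u t)\<bar>"
proof -
  have u: "u \<in> verts G" using sw awalk_in_verts unfolding shortest_walk_def by blast
  have main: "gdist a b + gdist u a = gdist u b"
    if a: "a \<in> set (awalk_verts u p)" and b: "b \<in> set (awalk_verts u p)"
      and le: "gdist u a \<le> gdist u b" for a b
  proof -
    obtain q r where qr: "p = q @ r" "awalk u q b" "length q = gdist u b"
      using shortest_walk_split(3)[OF sw b] by blast
    obtain q' r' where qr': "p = q' @ r'" "awalk u q' a" "length q' = gdist u a"
      using shortest_walk_split(3)[OF sw a] by blast
    obtain m where m: "q = q' @ m"
    proof
      have "take (length q') (q @ r) = q'" using qr(1) qr'(1) by (metis append_eq_conv_conj)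
      moreover have "length q' \<le> length q" using qr(3) qr'(3) le by simp
      ultimately have "take (length q') q = q'" by simp
      then show "q = q' @ drop (length q') q" by (metis append_take_drop_id)
    qed
    have "awlast u q' = a" using qr'(2) by (rule awalkE')
    then have "awalk a m b" using qr(2) unfolding m awalk_append_iff by simp
    then have "gdist a b \<le> length m" by (rule gdist_le)
    moreover have "length m + gdist u a = gdist u b" using m qr qr' by simp
    moreover have "gdist u b \<le> gdist u a + gdist a b"
      using gdist_triangle[OF u] shortest_walk_split(1)[OF sw] a b by blast
    ultimately show ?thesis by simp
  qed
  have "gdist s t = gdist t s" using gdist_sym shortest_walk_split(1)[OF sw] s t by blast
  then show ?thesis using main[OF s t] main[OF t s] by linarith
qed

lemma ex1_star_map:
  assumes tri: "geodesic_triangle x y z p q r"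
  shows "\<exists>!\<phi>. \<phi> \<in> extensional (triangle_verts x y z p q r) \<and> star_map x y z p q r \<phi>"
proof -
  define a b c where abc: "a = gromov y z x" "b = gromov z x y" "c = gromov x y z"
  have sp: "shortest_walk x p y" "shortest_walk y q z" "shortest_walk z r x"
    using tri by (simp_all add: geodesic_triangle_def)
  then have wk: "awalk x p y" "awalk y q z" "awalk z r x" by (simp_all add: shortest_walk_def)
  define V where "V = triangle_verts x y z p q r"
  have xyz: "x \<in> verts G" "y \<in> verts G" "z \<in> verts G"
    using wk[THEN awalk_in_verts(1)] .
  have ends: "x \<in> set (awalk_verts x p)" "y \<in> set (awalk_verts y q)" "z \<in> set (awalk_verts z r)"
    "y \<in> set (awalk_verts x p)" "z \<in> set (awalk_verts y q)" "x \<in> set (awalk_verts z r)"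
    using wk[THEN awalk_ends_in(1)] wk[THEN awalk_ends_in(2)] .
  have sy: "gdist y x = gdist x y" "gdist z y = gdist y z" "gdist x z = gdist z x"
    using gdist_sym xyz by blast+
  have ab: "a + b = gdist x y" "b + c = gdist y z" "c + a = gdist z x"
    by (simp_all add: abc gromov_def sy field_simps)
  have nn: "a \<ge> 0" "b \<ge> 0" "c \<ge> 0"
    using gdist_triangle[of y x z] gdist_triangle[of z y x] gdist_triangle[of x z y] xyz
    by (simp_all add: abc gromov_def sy)
  define f :: "real \<Rightarrow> real \<Rightarrow> real" where "f = (\<lambda>m n. max 0 (m - n))"
  define \<psi> where "\<psi> = (\<lambda>w. (f a (gdist x w), f b (gdist y w), f c (gdist z w)))"
  have fact: "w \<in> verts G" "gdist x w + gdist y w = gdist x y" "c \<le> gdist z w"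
    if w: "w \<in> set (awalk_verts x p)" for w
  proof -
    have sw: "shortest_walk x p y" by (rule sp)
    show v: "w \<in> verts G" using shortest_walk_split(1)[OF sw w] .
    show e: "gdist x w + gdist y w = gdist x y"
      using shortest_walk_split(2)[OF sw w] gdist_sym[OF xyz(2) v] by simp
    have "gdist z x \<le> gdist z w + gdist w x" "gdist z y \<le> gdist z w + gdist w y"
      using gdist_triangle v xyz by blast+
    then show "c \<le> gdist z w"
      using e ab gdist_sym[OF v xyz(1)] gdist_sym[OF v xyz(2)] sy by linarith
  qed
  have fact2: "w \<in> verts G" "gdist y w + gdist z w = gdist y z" "a \<le> gdist x w"
    if w: "w \<in> set (awalk_verts y q)" for w
  proof -
    have sw: "shortest_walk y q z" by (rule sp)
    show v: "w \<in> verts G" using shortest_walk_split(1)[OF sw w] .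
    show e: "gdist y w + gdist z w = gdist y z"
      using shortest_walk_split(2)[OF sw w] gdist_sym[OF xyz(3) v] by simp
    have "gdist x y \<le> gdist x w + gdist w y" "gdist x z \<le> gdist x w + gdist w z"
      using gdist_triangle v xyz by blast+
    then show "a \<le> gdist x w"
      using e ab gdist_sym[OF v xyz(2)] gdist_sym[OF v xyz(3)] sy by linarith
  qed
  have fact3: "w \<in> verts G" "gdist z w + gdist x w = gdist z x" "b \<le> gdist y w"
    if w: "w \<in> set (awalk_verts z r)" for w
  proof -
    have sw: "shortest_walk z r x" by (rule sp)
    show v: "w \<in> verts G" using shortest_walk_split(1)[OF sw w] .
    show e: "gdist z w + gdist x w = gdist z x"
      using shortest_walk_split(2)[OF sw w] gdist_sym[OF xyz(1) v] by simp
    have "gdist y z \<le> gdist y w + gdist w z" "gdist y x \<le> gdist y w + gdist w x"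
      using gdist_triangle v xyz by blast+
    then show "b \<le> gdist y w"
      using e ab gdist_sym[OF v xyz(3)] gdist_sym[OF v xyz(1)] sy by linarith
  qed
  have i1: "isometric_into \<psi> (set (awalk_verts x p)) (leg1 a \<union> leg2 b)"
    unfolding isometric_into_def
  proof (intro conjI ballI subsetI)
    fix t assume "t \<in> \<psi> ` set (awalk_verts x p)"
    then obtain w where w: "w \<in> set (awalk_verts x p)" "t = \<psi> w" by blast
    show "t \<in> leg1 a \<union> leg2 b"
      using fact[OF w(1)] ab nn unfolding w(2) \<psi>_def f_def leg1_def leg2_def
      by (auto simp: max_def image_iff)
  next
    fix s t assume st: "s \<in> set (awalk_verts x p)" "t \<in> set (awalk_verts x p)"
    have "real (gdist s t) = \<bar>real (gdist x s) - real (gdist x t)\<bar>"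
      by (rule shortest_walk_dist[OF sp(1) st])
    then show "star_dist (\<psi> s) (\<psi> t) = real (gdist s t)"
      using fact[OF st(1)] fact[OF st(2)] ab nn unfolding \<psi>_def f_def star_dist_def
      by (auto simp: max_def abs_if)
  qed
  have i2: "isometric_into \<psi> (set (awalk_verts y q)) (leg2 b \<union> leg3 c)"
    unfolding isometric_into_def
  proof (intro conjI ballI subsetI)
    fix t assume "t \<in> \<psi> ` set (awalk_verts y q)"
    then obtain w where w: "w \<in> set (awalk_verts y q)" "t = \<psi> w" by blast
    show "t \<in> leg2 b \<union> leg3 c"
      using fact2[OF w(1)] ab nn unfolding w(2) \<psi>_def f_def leg3_def leg2_def
      by (auto simp: max_def image_iff)
  next
    fix s t assume st: "s \<in> set (awalk_verts y q)" "t \<in> set (awalk_verts y q)"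
    have "real (gdist s t) = \<bar>real (gdist y s) - real (gdist y t)\<bar>"
      by (rule shortest_walk_dist[OF sp(2) st])
    then show "star_dist (\<psi> s) (\<psi> t) = real (gdist s t)"
      using fact2[OF st(1)] fact2[OF st(2)] ab nn unfolding \<psi>_def f_def star_dist_def
      by (auto simp: max_def abs_if)
  qed
  have i3: "isometric_into \<psi> (set (awalk_verts z r)) (leg3 c \<union> leg1 a)"
    unfolding isometric_into_def
  proof (intro conjI ballI subsetI)
    fix t assume "t \<in> \<psi> ` set (awalk_verts z r)"
    then obtain w where w: "w \<in> set (awalk_verts z r)" "t = \<psi> w" by blast
    show "t \<in> leg3 c \<union> leg1 a"
      using fact3[OF w(1)] ab nn unfolding w(2) \<psi>_def f_def leg3_def leg1_def
      by (auto simp: max_def image_iff)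
  next
    fix s t assume st: "s \<in> set (awalk_verts z r)" "t \<in> set (awalk_verts z r)"
    have "real (gdist s t) = \<bar>real (gdist z s) - real (gdist z t)\<bar>"
      by (rule shortest_walk_dist[OF sp(3) st])
    then show "star_dist (\<psi> s) (\<psi> t) = real (gdist s t)"
      using fact3[OF st(1)] fact3[OF st(2)] ab nn unfolding \<psi>_def f_def star_dist_def
      by (auto simp: max_def abs_if)
  qed
  have corners: "\<psi> x = (a, 0, 0)" "\<psi> y = (0, b, 0)" "\<psi> z = (0, 0, c)"
    using ab nn xyz sy by (auto simp: \<psi>_def f_def)
  define \<Phi> where "\<Phi> = restrict \<psi> V"
  have sub: "set (awalk_verts x p) \<subseteq> V" "set (awalk_verts y q) \<subseteq> V" "set (awalk_verts z r) \<subseteq> V"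
    by (auto simp: V_def triangle_verts_def)
  have cong: "isometric_into \<Phi> U S" if "isometric_into \<psi> U S" "U \<subseteq> V" for U S
    using that unfolding isometric_into_def \<Phi>_def by (auto simp: subset_iff image_subset_iff)
  have "star_map x y z p q r \<Phi>"
    unfolding star_map_def Let_def abc[symmetric]
    using cong[OF i1 sub(1)] cong[OF i2 sub(2)] cong[OF i3 sub(3)] corners ends sub
    by (auto simp: \<Phi>_def)
  moreover have "\<Phi> \<in> extensional V" by (simp add: \<Phi>_def)
  moreover have "\<phi> = \<Phi>" if e: "\<phi> \<in> extensional V" and m: "star_map x y z p q r \<phi>" for \<phi>
  proof (rule extensionalityI[OF e])
    show "\<Phi> \<in> extensional V" by (simp add: \<Phi>_def)
    fix w assume wV: "w \<in> V"
    have c: "\<phi> x = (a, 0, 0)" "\<phi> y = (0, b, 0)" "\<phi> z = (0, 0, c)"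
      "isometric_into \<phi> (set (awalk_verts x p)) (leg1 a \<union> leg2 b)"
      "isometric_into \<phi> (set (awalk_verts y q)) (leg2 b \<union> leg3 c)"
      "isometric_into \<phi> (set (awalk_verts z r)) (leg3 c \<union> leg1 a)"
      using m unfolding star_map_def Let_def abc[symmetric] by auto
    from wV consider "w \<in> set (awalk_verts x p)" | "w \<in> set (awalk_verts y q)"
      | "w \<in> set (awalk_verts z r)" by (auto simp: V_def triangle_verts_def)
    then have "\<phi> w = \<psi> w"
    proof cases
      case 1
      then have "\<phi> w \<in> leg1 a \<union> leg2 b" "star_dist (\<phi> x) (\<phi> w) = gdist x w"
        using c(4) ends unfolding isometric_into_def by auto
      then show ?thesis using fact[OF 1] ab nn unfolding c \<psi>_def f_def
        by (auto simp: leg1_def leg2_def star_dist_def)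
    next
      case 2
      then have "\<phi> w \<in> leg2 b \<union> leg3 c" "star_dist (\<phi> y) (\<phi> w) = gdist y w"
        using c(5) ends unfolding isometric_into_def by auto
      then show ?thesis using fact2[OF 2] ab nn unfolding c \<psi>_def f_def
        by (auto simp: leg3_def leg2_def star_dist_def)
    next
      case 3
      then have "\<phi> w \<in> leg3 c \<union> leg1 a" "star_dist (\<phi> z) (\<phi> w) = gdist z w"
        using c(6) ends unfolding isometric_into_def by auto
      then show ?thesis using fact3[OF 3] ab nn unfolding c \<psi>_def f_def
        by (auto simp: leg3_def leg1_def star_dist_def)
    qed
    then show "\<phi> w = \<Phi> w" using wV by (simp add: \<Phi>_def)
  qed
  ultimately show ?thesis unfolding V_def by blast
qed

end

end

theory Submission
  imports Defs
begin

text \<open>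
  Only intervals matter, not the chosen sides.  Let \<open>u \<in> I(x,y)\<close> and \<open>v \<in> I(x,z)\<close> lie at distance
  \<open>k \<le> (y | z)\<^sub>x\<close> from \<open>x\<close>, and let \<open>u'\<close>, \<open>v'\<close> be their predecessors on geodesics from \<open>x\<close>.  Suppose
  that the bound holds at level \<open>k - 1\<close> and fails at level \<open>k\<close>.  Then \<open>d(u',v') < d(u,v)\<close>, so
  the distance grows along \<open>u' u\<close> or along \<open>v' v\<close>, and the \<open>\<alpha>\<^sub>i\<close>-property gives
  \<open>d(v,y) \<ge> d(u,v) + d(u,y) - i\<close> or \<open>d(u',z) \<ge> d(u,v) + d(v,z) - i\<close>.

  If \<open>y = z\<close>, this is a contradiction as soon as \<open>d(u,v) > i + 1\<close>, so intervals are
  \<open>(i+1)\<close>-thin.  In general, it yields a vertex \<open>w\<close> of one side which is much too far from the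
  opposite corner: both Gromov products based at \<open>w\<close> with that corner exceed \<open>i + 1\<close>.  Walk from \<open>w\<close>
  towards that corner.  By the \<open>\<alpha>\<^sub>i\<close>-property the first \<open>i + 2\<close> steps cannot increase the distance
  to either end of the side, so they stay in the slice of the interval that contains \<open>w\<close>,
  contrary to its thinness.
\<close>

text \<open>Different legs share only the centre, so the images of two sides overlap just in their
  common leg. This bounds the distance from a corner to vertices with equal image by a Gromov
  product.\<close>

lemma star_dist_corner:
  assumes "a \<ge> 0" "b \<ge> 0" "c \<ge> 0"
  shows "t \<in> (leg1 a \<union> leg2 b) \<inter> (leg3 c \<union> leg1 a) \<Longrightarrow> star_dist (a, 0, 0) t \<le> a"
    "t \<in> (leg2 b \<union> leg3 c) \<inter> (leg1 a \<union> leg2 b) \<Longrightarrow> star_dist (0, b, 0) t \<le> b"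
    "t \<in> (leg3 c \<union> leg1 a) \<inter> (leg2 b \<union> leg3 c) \<Longrightarrow> star_dist (0, 0, c) t \<le> c"
  using assms by (auto simp: leg1_def leg2_def leg3_def star_dist_def)

section \<open>Distances across edges, and intervals\<close>

context connected_graph
begin

lemma gdist_adj_le:
  assumes "u \<rightarrow>\<^bsub>G\<^esub> v" "w \<in> verts G"
  shows "gdist w v \<le> gdist w u + 1" "gdist w u \<le> gdist w v + 1"
proof -
  have uv: "u \<in> verts G" "v \<in> verts G" using assms(1) by auto
  obtain e where "e \<in> arcs G" "tail G e = u" "head G e = v" using assms(1) by auto
  then have "awalk u [e] v" by (auto simp: awalk_Cons_iff awalk_Nil_iff)
  then have "gdist u v \<le> 1" "gdist v u \<le> 1"
    using gdist_le[of u "[e]" v] gdist_sym[OF uv] by simp_all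
  then show "gdist w v \<le> gdist w u + 1" "gdist w u \<le> gdist w v + 1"
    using gdist_triangle[of w u v] gdist_triangle[of w v u] uv assms(2)
    by linarith+
qed

lemma gdist_adj: "u \<rightarrow>\<^bsub>G\<^esub> v \<Longrightarrow> gdist u v = 1"
proof -
  assume a: "u \<rightarrow>\<^bsub>G\<^esub> v"
  have uv: "u \<in> verts G" "v \<in> verts G" using a by auto
  have "u \<noteq> v" using a adj_not_same by blast
  obtain q where "awalk u q v" "length q = gdist u v" using ex_shortest uv by blast
  with \<open>u \<noteq> v\<close> have "gdist u v \<noteq> 0" by (cases q) (auto simp: awalk_Nil_iff)
  with gdist_adj_le(1)[OF a uv(1)] uv show ?thesis by simp
qed

text \<open>The arc points from the closer vertex back to \<open>u\<close>, the orientation in which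
  \<open>alphaD\<close> and \<open>diverging_edges\<close> take it.\<close>

lemma ex_step_towards:
  assumes "u \<in> verts G" "v \<in> verts G" "u \<noteq> v"
  obtains w where "w \<rightarrow>\<^bsub>G\<^esub> u" "gdist u v = gdist w v + 1"
proof -
  obtain q where q: "awalk u q v" "length q = gdist u v" using ex_shortest assms by blast
  then obtain e q' where "q = e # q'" using assms(3) by (cases q) (auto simp: awalk_Nil_iff)
  with q have e: "e \<in> arcs G" "tail G e = u" "awalk (head G e) q' v" "Suc (length q') = gdist u v"
    by (auto simp: awalk_Cons_iff)
  have a: "u \<rightarrow>\<^bsub>G\<^esub> head G e" using in_arcs_imp_in_arcs_ends[OF e(1)] e(2) by simp
  have "gdist (head G e) v \<le> length q'" using e(3) by (rule gdist_le)
  moreover have "gdist v u \<le> gdist v (head G e) + 1"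
    using gdist_adj_le(2)[OF a assms(2)] .
  ultimately have "gdist u v = gdist (head G e) v + 1"
    using e(4) gdist_sym[OF assms(1,2)] gdist_sym[of v "head G e"] a assms adj_in_verts(2)[OF a]
    by linarith
  with graph_symmetric[OF a] that show ?thesis by blast
qed

lemma interval_sym: "x \<in> verts G \<Longrightarrow> y \<in> verts G \<Longrightarrow> interval x y = interval y x"
  unfolding interval_def using gdist_sym by auto

lemma shortest_walk_in_interval:
  "shortest_walk x p y \<Longrightarrow> set (awalk_verts x p) \<subseteq> interval x y"
  using shortest_walk_split(1,2) unfolding interval_def by blast

lemma gromov_nonneg:
  assumes "x \<in> verts G" "y \<in> verts G" "z \<in> verts G"
  shows "gromov y z x \<ge> 0"
  using gdist_triangle[of y x z] gdist_sym[of x z] assms by (simp add: gromov_def)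

end

section \<open>Diverging edges and thin intervals\<close>

locale alpha_metric_graph = connected_graph +
  fixes i :: nat
  assumes alpha: "alpha_metric i"
begin

lemma alphaD:
  assumes "v \<rightarrow>\<^bsub>G\<^esub> w" "u \<in> verts G" "x \<in> verts G"
    and "gdist u w = gdist u v + 1" "gdist v x = gdist w x + 1"
  shows "gdist u v + gdist v x \<le> gdist u x + i"
proof -
  have vw: "v \<in> verts G" "w \<in> verts G" using assms(1) by auto
  have "v \<in> interval u w" "w \<in> interval v x"
    using assms vw gdist_adj[OF assms(1)] by (auto simp: interval_def)
  then have "int (gdist u x) \<ge> int (gdist u v) + int (gdist v x) - int i"
    using alpha vw assms unfolding alpha_metric_def by blast
  then show ?thesis by linarith
qed

lemma diverging_edges:
  assumes adj: "u' \<rightarrow>\<^bsub>G\<^esub> u" "v' \<rightarrow>\<^bsub>G\<^esub> v" and yz: "y \<in> verts G" "z \<in> verts G"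
    and uy: "gdist u' y = gdist u y + 1" and vz: "gdist v' z = gdist v z + 1"
    and less: "gdist u' v' < gdist u v"
  shows "gdist u v + gdist u y \<le> gdist v y + i \<or> gdist u v + gdist v z \<le> gdist u' z + i"
proof -
  have V: "u \<in> verts G" "u' \<in> verts G" "v \<in> verts G" "v' \<in> verts G" using adj by auto
  have "gdist u' v \<le> gdist u' v' + 1" by (rule gdist_adj_le(1)[OF adj(2) V(2)])
  moreover have "gdist v u \<le> gdist v u' + 1" by (rule gdist_adj_le(1)[OF adj(1) V(3)])
  moreover have sym: "gdist v u = gdist u v" "gdist v u' = gdist u' v" using gdist_sym V by auto
  \<comment> \<open>Going from \<open>(u', v')\<close> through \<open>(u', v)\<close> to
    \<open>(u, v)\<close>, each move adds at most 1 to the distance and the total strictly grows. So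
    either the second move adds 1, or the first adds 1 and the second nothing.\<close>
  ultimately consider "gdist u v = gdist u' v + 1"
    | "gdist u' v = gdist u' v' + 1" "gdist u' v = gdist u v"
    using less by linarith
  then show ?thesis
  proof cases
    case 1
    then show ?thesis using alphaD[OF adj(1) V(3) yz(1)] uy sym by simp
  next
    case 2
    then show ?thesis using alphaD[OF adj(2) V(2) yz(2)] vz by simp
  qed
qed

lemma interval_predecessor:
  assumes x: "x \<in> verts G" and y: "y \<in> verts G" and u: "u \<in> interval x y"
    and k: "gdist x u = Suc k"
  obtains u' where "u' \<rightarrow>\<^bsub>G\<^esub> u" "u' \<in> interval x y" "gdist x u' = k" "gdist u' y = gdist u y + 1"
proof -
  have uV: "u \<in> verts G" and uI: "gdist x y = gdist x u + gdist u y"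
    using u by (auto simp: interval_def)
  have "u \<noteq> x" using k x by auto
  then obtain w where w: "w \<rightarrow>\<^bsub>G\<^esub> u" "gdist u x = gdist w x + 1" using ex_step_towards uV x by blast
  have wV: "w \<in> verts G" using w by auto
  have "gdist x w = k" using w k gdist_sym uV wV x by simp
  moreover have "gdist y w \<le> gdist y u + 1" using gdist_adj_le(2)[OF w(1) y] .
  moreover have "gdist x y \<le> gdist x w + gdist w y" using gdist_triangle x y wV by blast
  ultimately have "gdist x w = k" "gdist w y = gdist u y + 1"
    using uI k gdist_sym[OF y] wV uV by auto
  moreover from this have "w \<in> interval x y" using uI k wV by (simp add: interval_def)
  ultimately show ?thesis using that w(1) by blast
qed

lemma interval_thin:
  assumes xy: "x \<in> verts G" "y \<in> verts G"
    and "u \<in> interval x y" "v \<in> interval x y" "gdist x u = k" "gdist x v = k"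
  shows "gdist u v \<le> i + 1"
  using assms(3-)
proof (induction k arbitrary: u v)
  case 0
  have "u \<in> verts G" "v \<in> verts G" using 0 by (auto simp: interval_def)
  then show ?case using 0 gdist_triangle[of u x v] gdist_sym[of u x] xy by simp
next
  case (Suc k)
  obtain u' where u': "u' \<rightarrow>\<^bsub>G\<^esub> u" "u' \<in> interval x y" "gdist x u' = k" "gdist u' y = gdist u y + 1"
    by (rule interval_predecessor[OF xy Suc.prems(1,3)])
  obtain v' where v': "v' \<rightarrow>\<^bsub>G\<^esub> v" "v' \<in> interval x y" "gdist x v' = k" "gdist v' y = gdist v y + 1"
    by (rule interval_predecessor[OF xy Suc.prems(2,4)])
  have e: "gdist v y = gdist u y" using Suc.prems by (simp add: interval_def)
  have IH: "gdist u' v' \<le> i + 1" using Suc.IH u' v' by blast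
  show ?case
  proof (cases "gdist u' v' < gdist u v")
    case True
    \<comment> \<open>By \<open>e\<close>, the first alternative gives distance at most
      \<open>i\<close>; the second gives \<open>i + 1\<close>, because \<open>u'\<close> is one step
      further from \<open>y\<close> than \<open>u\<close>.\<close>
    from diverging_edges[OF u'(1) v'(1) xy(2) xy(2) u'(4) v'(4) this] show ?thesis
      using u'(4) e by (elim disjE) linarith+
  next
    case False
    then show ?thesis using IH by linarith
  qed
qed

text \<open>This says that one of the Gromov products \<open>(x | z)\<close>, \<open>(y | z)\<close>
  based at \<open>w\<close> is at most \<open>i + 1\<close>, doubled to stay within
  \<open>nat\<close>.\<close>

lemma interval_gromov_bound:
  assumes xyz: "x \<in> verts G" "y \<in> verts G" "z \<in> verts G" and w: "w \<in> interval x y"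
  shows "gdist w x + gdist w z \<le> gdist x z + 2 * i + 2
    \<or> gdist w y + gdist w z \<le> gdist y z + 2 * i + 2"
proof (rule ccontr)
  assume "\<not> ?thesis"
  then have far: "gdist w x + gdist w z > gdist x z + 2 * i + 2"
    "gdist w y + gdist w z > gdist y z + 2 * i + 2" by auto
  have wV: "w \<in> verts G" and wI: "gdist x y = gdist x w + gdist w y"
    using w by (auto simp: interval_def)
  have sym: "gdist a b = gdist b a" if "a \<in> verts G" "b \<in> verts G" for a b
    using gdist_sym that .
  \<comment> \<open>A Gromov product based at \<open>w\<close> is at most \<open>gdist w z\<close>,
    so the walk towards \<open>z\<close> has room for \<open>i + 2\<close> steps.\<close>
  have large: "gdist w z \<ge> i + 2"
    using far gdist_triangle[of w z x] sym[of z x] xyz wV by auto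
  have step: "\<exists>r. r \<in> verts G \<and> gdist x r = gdist x w \<and> gdist r y = gdist w y
      \<and> gdist r z + j = gdist w z" if "j \<le> i + 2" for j
    using that
  proof (induction j)
    case 0
    then show ?case using wV by auto
  next
    case (Suc j)
    then obtain r where r: "r \<in> verts G" "gdist x r = gdist x w" "gdist r y = gdist w y"
      "gdist r z + j = gdist w z" by auto
    have "r \<noteq> z" using r(4) large Suc.prems xyz by auto
    then obtain r' where r': "r' \<rightarrow>\<^bsub>G\<^esub> r" "gdist r z = gdist r' z + 1"
      using ex_step_towards r xyz by blast
    have r'V: "r' \<in> verts G" using r'(1) by auto
    \<comment> \<open>The edge from \<open>r'\<close> to \<open>r\<close> leads away from
      \<open>z\<close>. If it also led towards \<open>a\<close>, \<open>alphaD\<close> would give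
      \<open>gdist r a + gdist w z \<le> gdist a z + i + j\<close>, which is too small since
      \<open>j \<le> i + 1\<close>.\<close>
    have bnd: "gdist r' a \<le> gdist r a"
      if a: "a \<in> verts G" "gdist r a + gdist w z > gdist a z + 2 * i + 2" for a
    proof (rule ccontr)
      assume "\<not> gdist r' a \<le> gdist r a"
      then have inc: "gdist r' a = gdist r a + 1"
        using gdist_adj_le(2)[OF r'(1) a(1)] sym a(1) r(1) r'V by auto
      have "gdist z r' + gdist r' a \<le> gdist z a + i"
        by (rule alphaD[OF r'(1) xyz(3) a(1)]) (use inc r' r r'V xyz sym in auto)
      then show False using a inc r(4) r'(2) Suc.prems sym[of z] r'V xyz by auto
    qed
    have "gdist r' x \<le> gdist x w" "gdist r' y \<le> gdist w y"
      using bnd[of x] bnd[of y] far r sym[of r x] sym[of w x] xyz wV by auto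
    moreover have "gdist x y \<le> gdist x r' + gdist r' y" using gdist_triangle xyz r'V by blast
    \<comment> \<open>Neither distance has grown, and their sum cannot drop below
      \<open>gdist x y\<close>.\<close>
    ultimately have "gdist x r' = gdist x w \<and> gdist r' y = gdist w y"
      using wI sym[of r' x] xyz r'V by auto
    then show ?case using r' r r'V by auto
  qed
  obtain r where r: "r \<in> verts G" "gdist x r = gdist x w" "gdist r y = gdist w y"
    "gdist r z + (i + 2) = gdist w z" using step[of "i + 2"] by auto
  then have "r \<in> interval x y" using wI by (simp add: interval_def)
  then have "gdist w r \<le> i + 1" using interval_thin xyz w r(2) by blast
  \<comment> \<open>The walk has made \<open>i + 2\<close> steps of progress towards
    \<open>z\<close>, one more than the width of the slice.\<close>
  then show False using r(4) gdist_triangle[of w r z] r(1) wV xyz by auto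
qed

section \<open>Two sides leaving a common corner\<close>

lemma corner_thin:
  assumes xyz: "x \<in> verts G" "y \<in> verts G" "z \<in> verts G"
    and "u \<in> interval x y" "v \<in> interval x z" "gdist x u = k" "gdist x v = k"
    and "2 * k + gdist y z \<le> gdist x y + gdist x z"
  shows "gdist u v \<le> 3 * i + 3"
  using assms(4-)
proof (induction k arbitrary: u v)
  case 0
  have "u \<in> verts G" "v \<in> verts G" using 0 by (auto simp: interval_def)
  then show ?case using 0 gdist_triangle[of u x v] gdist_sym[of u x] xyz by simp
next
  case (Suc k)
  have V: "u \<in> verts G" "v \<in> verts G" using Suc.prems by (auto simp: interval_def)
  obtain u' where u': "u' \<rightarrow>\<^bsub>G\<^esub> u" "u' \<in> interval x y" "gdist x u' = k" "gdist u' y = gdist u y + 1"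
    by (rule interval_predecessor[OF xyz(1,2) Suc.prems(1,3)])
  obtain v' where v': "v' \<rightarrow>\<^bsub>G\<^esub> v" "v' \<in> interval x z" "gdist x v' = k" "gdist v' z = gdist v z + 1"
    by (rule interval_predecessor[OF xyz(1,3) Suc.prems(2,4)])
  have "u' \<in> verts G" using u' by auto
  then have sym: "gdist u' x = gdist x u'" "gdist v x = gdist x v" "gdist z y = gdist y z"
    using gdist_sym V xyz by auto
  have I: "gdist x y = gdist x u + gdist u y" "gdist x z = gdist x v + gdist v z"
    using Suc.prems by (auto simp: interval_def)
  have less: "gdist y z \<le> gdist u y + gdist v z" using I Suc.prems by simp
  have IH: "gdist u' v' \<le> 3 * i + 3" using Suc.IH u' v' Suc.prems by auto
  show ?case
  proof (rule ccontr)
    assume m: "\<not> ?thesis"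
    then have "gdist u' v' < gdist u v" using IH by linarith
    then consider "gdist u v + gdist u y \<le> gdist v y + i" | "gdist u v + gdist v z \<le> gdist u' z + i"
      using diverging_edges[OF u'(1) v'(1) xyz(2,3) u'(4) v'(4)] by blast
    then show False
    \<comment> \<open>Failure means \<open>gdist u v \<ge> 3 * i + 4\<close>. The \<alpha>-property
      costs \<open>i\<close>, leaving an excess of \<open>2 * i + 4\<close> at \<open>w = v\<close>
      in the first case. In the second case \<open>w = u'\<close> is one step closer to
      \<open>x\<close>, which still leaves \<open>2 * i + 3\<close>.\<close>
    proof cases
      case 1
      then show False
        using interval_gromov_bound[OF xyz(1,3,2) Suc.prems(2)] I sym m Suc.prems(3,4) less
        by (elim disjE) linarith+
    next
      case 2
      then show False
        using interval_gromov_bound[OF xyz u'(2)] I sym m u'(3,4) Suc.prems(3,4) less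
        by (elim disjE) linarith+
    qed
  qed
qed

lemma corner_thin_gromov:
  assumes "x \<in> verts G" "y \<in> verts G" "z \<in> verts G"
    and "u \<in> interval x y" "v \<in> interval z x" "gdist x u = gdist x v"
    and "real (gdist x u) \<le> gromov y z x"
  shows "gdist u v \<le> 3 * i + 3" "gdist v u \<le> 3 * i + 3"
proof -
  have "2 * real (gdist x u) + real (gdist y z) \<le> real (gdist x y) + real (gdist x z)"
    using assms(7) gdist_sym assms(1-3) by (simp add: gromov_def)
  then have "2 * gdist x u + gdist y z \<le> gdist x y + gdist x z" by linarith
  moreover have "v \<in> interval x z" using assms interval_sym by blast
  ultimately show "gdist u v \<le> 3 * i + 3"
    using corner_thin[OF assms(1-4) _ refl assms(6)[symmetric]] by blast
  moreover have "u \<in> verts G" "v \<in> verts G" using assms by (auto simp: interval_def)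
  ultimately show "gdist v u \<le> 3 * i + 3" using gdist_sym[of u v] by simp
qed

text \<open>The sides are oriented cyclically, so this one form serves all three corners by rotating
  \<open>x\<close>, \<open>y\<close>, \<open>z\<close>; \<open>star_dist_corner\<close> supplies
  \<open>near\<close>.\<close>

lemma isometric_corner_thin:
  assumes xyz: "x \<in> verts G" "y \<in> verts G" "z \<in> verts G"
    and S: "isometric_into \<phi> S A" "S \<subseteq> interval x y" "x \<in> S"
    and T: "isometric_into \<phi> T B" "T \<subseteq> interval z x" "x \<in> T"
    and near: "\<And>t. t \<in> A \<inter> B \<Longrightarrow> star_dist (\<phi> x) t \<le> gromov y z x"
    and uv: "u \<in> S" "v \<in> T" "\<phi> u = \<phi> v"
  shows "gdist u v \<le> 3 * i + 3" "gdist v u \<le> 3 * i + 3"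
proof -
  have u: "real (gdist x u) = star_dist (\<phi> x) (\<phi> u)" "\<phi> u \<in> A"
    using S(1,3) uv(1) unfolding isometric_into_def by (simp_all add: image_subset_iff)
  have v: "real (gdist x v) = star_dist (\<phi> x) (\<phi> v)" "\<phi> v \<in> B"
    using T(1,3) uv(2) unfolding isometric_into_def by (simp_all add: image_subset_iff)
  have "real (gdist x u) \<le> gromov y z x" using near[of "\<phi> u"] u v uv(3) by simp
  moreover have "gdist x u = gdist x v" using u v uv(3) by simp
  moreover have "u \<in> interval x y" "v \<in> interval z x" using S T uv by auto
  ultimately show "gdist u v \<le> 3 * i + 3" "gdist v u \<le> 3 * i + 3"
    using corner_thin_gromov[OF xyz] by blast+
qed

lemma thin_triangle:
  assumes tri: "geodesic_triangle x y z p q r"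
  shows "thin_triangle (3 * (real i + 1)) x y z p q r"
  unfolding thin_triangle_def
proof (intro allI impI ballI)
  fix \<phi> u v
  assume star: "star_map x y z p q r \<phi>" and eq: "\<phi> u = \<phi> v"
    and uT: "u \<in> triangle_verts x y z p q r" and vT: "v \<in> triangle_verts x y z p q r"
  define a b c where abc: "a = gromov y z x" "b = gromov z x y" "c = gromov x y z"
  define P Q R where PQR: "P = set (awalk_verts x p)" "Q = set (awalk_verts y q)"
    "R = set (awalk_verts z r)"
  have sp: "shortest_walk x p y" "shortest_walk y q z" "shortest_walk z r x"
    using tri by (simp_all add: geodesic_triangle_def)
  then have wk: "awalk x p y" "awalk y q z" "awalk z r x" by (simp_all add: shortest_walk_def)
  have xyz: "x \<in> verts G" "y \<in> verts G" "z \<in> verts G"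
    using wk[THEN awalk_in_verts(1)] .
  have nn: "a \<ge> 0" "b \<ge> 0" "c \<ge> 0" using gromov_nonneg xyz by (simp_all add: abc)
  have ends: "x \<in> P" "y \<in> Q" "z \<in> R" "y \<in> P" "z \<in> Q" "x \<in> R"
    using wk[THEN awalk_ends_in(1)] wk[THEN awalk_ends_in(2)] unfolding PQR .
  have int: "P \<subseteq> interval x y" "Q \<subseteq> interval y z" "R \<subseteq> interval z x"
    unfolding PQR using sp[THEN shortest_walk_in_interval] .
  have corners: "\<phi> x = (a, 0, 0)" "\<phi> y = (0, b, 0)" "\<phi> z = (0, 0, c)"
    and iso: "isometric_into \<phi> P (leg1 a \<union> leg2 b)" "isometric_into \<phi> Q (leg2 b \<union> leg3 c)"
      "isometric_into \<phi> R (leg3 c \<union> leg1 a)"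
    using star unfolding star_map_def Let_def abc[symmetric] PQR[symmetric] by auto
  \<comment> \<open>Each pair of distinct sides has its own common corner: \<open>X\<close>,
    \<open>Y\<close> and \<open>Z\<close> treat the three pairs, in both orders.\<close>
  have X: "gdist s t \<le> 3 * i + 3 \<and> gdist t s \<le> 3 * i + 3"
    if "s \<in> P" "t \<in> R" "\<phi> s = \<phi> t" for s t
    using isometric_corner_thin[OF xyz iso(1) int(1) ends(1) iso(3) int(3) ends(6) _ that]
      star_dist_corner(1)[OF nn] by (simp add: corners abc(1))
  have Y: "gdist s t \<le> 3 * i + 3 \<and> gdist t s \<le> 3 * i + 3"
    if "s \<in> Q" "t \<in> P" "\<phi> s = \<phi> t" for s t
    using isometric_corner_thin[OF xyz(2,3,1) iso(2) int(2) ends(2) iso(1) int(1) ends(4) _ that]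
      star_dist_corner(2)[OF nn] by (simp add: corners abc(2))
  have Z: "gdist s t \<le> 3 * i + 3 \<and> gdist t s \<le> 3 * i + 3"
    if "s \<in> R" "t \<in> Q" "\<phi> s = \<phi> t" for s t
    using isometric_corner_thin[OF xyz(3,1,2) iso(3) int(3) ends(3) iso(2) int(2) ends(5) _ that]
      star_dist_corner(3)[OF nn] by (simp add: corners abc(3))
  \<comment> \<open>If \<open>u\<close> and \<open>v\<close> lie on one side, isometry makes equal
    images collapse to distance 0.\<close>
  have same: "gdist u v = 0" if "isometric_into \<phi> U A" "u \<in> U" "v \<in> U" for U A
  proof -
    have "star_dist (\<phi> u) (\<phi> v) = real (gdist u v)" using that by (simp add: isometric_into_def)
    then show ?thesis by (simp add: eq star_dist_def split: prod.splits)
  qed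
  have "u \<in> P \<or> u \<in> Q \<or> u \<in> R" "v \<in> P \<or> v \<in> Q \<or> v \<in> R"
    using uT vT by (auto simp: triangle_verts_def PQR)
  then have "gdist u v \<le> 3 * i + 3"
    using X[of u v] X[of v u] Y[of u v] Y[of v u] Z[of u v] Z[of v u] eq
      same[OF iso(1)] same[OF iso(2)] same[OF iso(3)] by (elim disjE) simp_all
  then show "real (gdist u v) \<le> 3 * (real i + 1)" by simp
qed

end

theorem theorem1:
  fixes G :: "('a, 'b) pre_digraph" and i :: nat
  assumes "graph G" and "Digraph_Component.connected G"
    and "pre_digraph.alpha_metric G i"
  shows "\<forall>x y z p q r. pre_digraph.geodesic_triangle G x y z p q r \<longrightarrow>
    pre_digraph.thin_triangle G (3 * (real i + 1)) x y z p q r"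
proof -
  interpret graph G by (rule assms)
  interpret alpha_metric_graph G i by unfold_locales (rule assms)+
  show ?thesis using thin_triangle by blast
qed

end
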